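(* Let $D$ be a link diagram with $N$ crossings. (+) If $D$ is $+$-adequate and the graph $G_{s_+}(D)$ has a cycle of odd length, then the Khovanov homology of $D$ has $\mathbb{Z}_2$ torsion; more precisely, $H_{N-2,\,N+2|s_+|-4}(D)$ has $\mathbb{Z}_2$ torsion. (-) If $D$ is $-$-adequate and the graph $G_{s_-}(D)$ has a cycle of odd length, then $H_{-N,\,-N-2|s_-|+4}(D)$ has $\mathbb{Z}_2$ torsion.
   Context: Diagrams: $D$ is a diagram in the plane (disc) of an unoriented framed link, with ordered crossings. At each crossing there are two smoothings: the positive-marker smoothing ($A$-smoothing) joins the two local regions swept out when the overcrossing arc is rotated counterclockwise until it meets the undercrossing arc; the negative-marker smoothing joins the other two regions. A Kauffman state $s$ assigns $+1$ or $-1$ (a positive or negative marker) to each crossing; $D_s$ is the system of circles obtained by smoothing all crossings according to $s$, $|s|$ is the number of circles of $D_s$, and $\sigma(s)$ is the number of positive minus the number of negative markers. $s_+$ (resp. $s_-$) is the state with all markers positive (resp. negative). Khovanov homology: an enhanced state $S$ is a Kauffman state $s$ with a sign $+$ or $-$ on each circle of $D_s$; put $\sigma(S)=\sigma(s)$ and $\tau(S)=\#\{\text{positive circles}\}-\#\{\text{negative circles}\}$. $\mathcal{C}_{i,j}(D)$ is the free abelian group on enhanced states with $\sigma(S)=i$ and $\sigma(S)+2\tau(S)=j$. The differential $d_{i,j}:\mathcal{C}_{i,j}(D)\to\mathcal{C}_{i-2,j}(D)$ is $d(S)=\sum_{S'}(-1)^{t(S:S')}[S:S']S'$, the sum over enhanced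 states $S'$ generating $\mathcal C_{i-2,j}(D)$, where $[S:S']=1$ if the markers of $S$ and $S'$ differ at exactly one crossing $v$ and all circles not touching $v$ have the same sign in $S$ and $S'$, and $[S:S']=0$ otherwise; $t(S:S')$ is the number of negative markers of $S$ at crossings bigger than $v$ in the ordering. $H_{i,j}(D)=\ker(d_{i,j})/\mathrm{im}(d_{i+2,j})$. Graphs: $G_s(D)$ has a vertex for each circle of $D_s$ and an edge for each crossing of $D$, the edge joining the vertices of the circles of $D_s$ met at that crossing (multiple edges and loops allowed). $D$ is $+$-adequate (resp. $-$-adequate) if $G_{s_+}(D)$ (resp. $G_{s_-}(D)$) has no loops. "Has $\mathbb{Z}_2$ torsion" means: contains an element of order $2$. *)

theory Defs
  imports "HOL-Algebra.Free_Abelian_Groups" "HOL-Algebra.Multiplicative_Group"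
begin

text \<open>
  Link diagrams in the plane are encoded by planar-diagram codes.  The crossings are
  \<open>0, \<dots>, num_crossings D - 1\<close>, listed in their given order.  Each crossing \<open>c\<close> has four ends
  (darts) \<open>(c, 0), (c, 1), (c, 2), (c, 3)\<close> in counterclockwise order, such that \<open>(c, 0)\<close>,
  \<open>(c, 2)\<close> form the undercrossing arc and \<open>(c, 1)\<close>, \<open>(c, 3)\<close> the overcrossing arc; \<open>glue D\<close>
  sends each dart to the other end of its edge.  Components of the link without any crossing
  are not seen by darts, so their number is recorded separately.  The framing is the
  blackboard framing.
\<close>

type_synonym dart = "nat \<times> nat"

record diagram =
  num_crossings :: nat
  glue :: "dart \<Rightarrow> dart"
  free_circles :: nat

definition darts :: "diagram \<Rightarrow> dart set" where
  "darts D = {..<num_crossings D} \<times> {..<4}"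

definition rotate_dart :: "dart \<Rightarrow> dart" where
  "rotate_dart = (\<lambda>(c, k). (c, (k + 1) mod 4))"

text \<open>
  The forward closures of the points of \<open>A\<close> under the maps in \<open>F\<close>; when \<open>A\<close> is finite and
  every map in \<open>F\<close> permutes \<open>A\<close>, these are the orbits of the group generated by \<open>F\<close>.
\<close>

definition orbits :: "'a set \<Rightarrow> ('a \<Rightarrow> 'a) set \<Rightarrow> 'a set set" where
  "orbits A F = (\<lambda>x. {(y, f y) | y f. f \<in> F}\<^sup>* `` {x}) ` A"

text \<open>
  Planarity is Euler's formula: there are \<open>N\<close> vertices, \<open>2 N\<close> edges, the faces are the orbits
  of \<open>rotate_dart \<circ> glue D\<close>, and \<open>V - E + F\<close> is twice the number of connected components
  exactly if every component of the underlying 4-valent graph has genus 0.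
\<close>

definition link_diagram :: "diagram \<Rightarrow> bool" where
  "link_diagram D \<longleftrightarrow>
     (\<forall>d \<in> darts D. glue D d \<in> darts D \<and> glue D d \<noteq> d \<and> glue D (glue D d) = d) \<and>
     int (num_crossings D) - 2 * int (num_crossings D)
         + int (card (orbits (darts D) {rotate_dart \<circ> glue D}))
       = 2 * int (card (orbits (darts D) {glue D, rotate_dart}))"


datatype sign = Positive | Negative

type_synonym kauffman_state = "nat \<Rightarrow> sign"

definition states :: "diagram \<Rightarrow> kauffman_state set" where
  "states D = ({..<num_crossings D} \<rightarrow>\<^sub>E UNIV)"

definition s_plus :: "diagram \<Rightarrow> kauffman_state" where
  "s_plus D = (\<lambda>c \<in> {..<num_crossings D}. Positive)"

definition s_minus :: "diagram \<Rightarrow> kauffman_state" where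
  "s_minus D = (\<lambda>c \<in> {..<num_crossings D}. Negative)"

definition sigma :: "diagram \<Rightarrow> kauffman_state \<Rightarrow> int" where
  "sigma D s = int (card {c. c < num_crossings D \<and> s c = Positive})
             - int (card {c. c < num_crossings D \<and> s c = Negative})"

text \<open>
  Rotating the overcrossing arc \<open>1\<close>--\<open>3\<close> counterclockwise onto the undercrossing arc sweeps out
  the region between the ends \<open>1\<close> and \<open>2\<close> and the region between \<open>3\<close> and \<open>0\<close>.  Joining these
  two regions leaves an arc from \<open>0\<close> to \<open>1\<close> and an arc from \<open>2\<close> to \<open>3\<close>; the negative smoothing
  leaves arcs \<open>1\<close>--\<open>2\<close> and \<open>3\<close>--\<open>0\<close>.
\<close>

definition smoothing :: "kauffman_state \<Rightarrow> dart \<Rightarrow> dart" where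
  "smoothing s = (\<lambda>(c, k).
     (c, case s c of
           Positive \<Rightarrow> (if k = 0 then 1 else if k = 1 then 0 else if k = 2 then 3 else 2)
         | Negative \<Rightarrow> (if k = 1 then 2 else if k = 2 then 1 else if k = 3 then 0 else 3)))"

text \<open>
  A circle of \<open>D\<^sub>s\<close> is given by the set of darts it runs through, or it is one of the
  crossingless components of the diagram.  Thus a circle that does not touch the crossing at
  which two states differ is the same object for both states.
\<close>

datatype circle = Through "dart set" | Free nat

definition circles :: "diagram \<Rightarrow> kauffman_state \<Rightarrow> circle set" where
  "circles D s = Through ` orbits (darts D) {glue D, smoothing s} \<union> Free ` {..<free_circles D}"

fun touches :: "circle \<Rightarrow> nat \<Rightarrow> bool" where
  "touches (Through X) c \<longleftrightarrow> (\<exists>k. (c, k) \<in> X)"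
| "touches (Free n) c \<longleftrightarrow> False"


text \<open>Undirected multigraphs; the end set of an edge has one element (loop) or two.\<close>

record ('v, 'e) multigraph =
  verts :: "'v set"
  edges :: "'e set"
  ends :: "'e \<Rightarrow> 'v set"

definition loopless :: "('v, 'e) multigraph \<Rightarrow> bool" where
  "loopless G \<longleftrightarrow> (\<forall>e \<in> edges G. card (ends G e) \<noteq> 1)"

definition is_cycle :: "('v, 'e) multigraph \<Rightarrow> 'v list \<Rightarrow> 'e list \<Rightarrow> bool" where
  "is_cycle G vs es \<longleftrightarrow>
     vs \<noteq> [] \<and> length es = length vs \<and> distinct vs \<and> distinct es \<and>
     set vs \<subseteq> verts G \<and> set es \<subseteq> edges G \<and>
     (\<forall>i < length vs. ends G (es ! i) = {vs ! i, vs ! (Suc i mod length vs)})"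

definition has_odd_cycle :: "('v, 'e) multigraph \<Rightarrow> bool" where
  "has_odd_cycle G \<longleftrightarrow> (\<exists>vs es. is_cycle G vs es \<and> odd (length es))"

definition state_graph :: "diagram \<Rightarrow> kauffman_state \<Rightarrow> (circle, nat) multigraph" where
  "state_graph D s =
     \<lparr>verts = circles D s, edges = {..<num_crossings D},
      ends = (\<lambda>c. {C \<in> circles D s. touches C c})\<rparr>"

definition plus_adequate :: "diagram \<Rightarrow> bool" where
  "plus_adequate D \<longleftrightarrow> loopless (state_graph D (s_plus D))"

definition minus_adequate :: "diagram \<Rightarrow> bool" where
  "minus_adequate D \<longleftrightarrow> loopless (state_graph D (s_minus D))"


type_synonym enhanced_state = "kauffman_state \<times> (circle \<Rightarrow> sign)"

definition enhanced_states :: "diagram \<Rightarrow> enhanced_state set" where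
  "enhanced_states D = (SIGMA s : states D. circles D s \<rightarrow>\<^sub>E UNIV)"

definition tau :: "diagram \<Rightarrow> enhanced_state \<Rightarrow> int" where
  "tau D = (\<lambda>(s, \<epsilon>). int (card {C \<in> circles D s. \<epsilon> C = Positive})
                   - int (card {C \<in> circles D s. \<epsilon> C = Negative}))"

definition generators :: "diagram \<Rightarrow> int \<Rightarrow> int \<Rightarrow> enhanced_state set" where
  "generators D i j =
     {S \<in> enhanced_states D. sigma D (fst S) = i \<and> sigma D (fst S) + 2 * tau D S = j}"

definition chain_group :: "diagram \<Rightarrow> int \<Rightarrow> int \<Rightarrow> (enhanced_state \<Rightarrow>\<^sub>0 int) monoid" where
  "chain_group D i j = free_Abelian_group (generators D i j)"

definition differing :: "diagram \<Rightarrow> enhanced_state \<Rightarrow> enhanced_state \<Rightarrow> nat set" where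
  "differing D S S' = {c. c < num_crossings D \<and> fst S c \<noteq> fst S' c}"

definition incidence :: "diagram \<Rightarrow> enhanced_state \<Rightarrow> enhanced_state \<Rightarrow> int" where
  "incidence D S S' =
     (if \<exists>v. differing D S S' = {v} \<and>
             (\<forall>C \<in> circles D (fst S) \<inter> circles D (fst S'). \<not> touches C v \<longrightarrow> snd S C = snd S' C)
      then 1 else 0)"

text \<open>Only relevant when \<open>differing D S S'\<close> is a singleton.\<close>

definition incidence_exponent :: "diagram \<Rightarrow> enhanced_state \<Rightarrow> enhanced_state \<Rightarrow> nat" where
  "incidence_exponent D S S' =
     card {c. c < num_crossings D \<and> the_elem (differing D S S') < c \<and> fst S c = Negative}"

definition differential ::
    "diagram \<Rightarrow> int \<Rightarrow> int \<Rightarrow> (enhanced_state \<Rightarrow>\<^sub>0 int) \<Rightarrow> (enhanced_state \<Rightarrow>\<^sub>0 int)" where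
  "differential D i j = frag_extend (\<lambda>S. \<Sum>S' \<in> generators D (i - 2) j.
     frag_cmul ((- 1) ^ incidence_exponent D S S' * incidence D S S') (frag_of S'))"

definition khovanov_homology ::
    "diagram \<Rightarrow> int \<Rightarrow> int \<Rightarrow> (enhanced_state \<Rightarrow>\<^sub>0 int) set monoid" where
  "khovanov_homology D i j =
     subgroup_generated (chain_group D i j)
       (kernel (chain_group D i j) (chain_group D (i - 2) j) (differential D i j))
     Mod (differential D (i + 2) j ` carrier (chain_group D (i + 2) j))"

definition has_Z2_torsion :: "('a, 'b) monoid_scheme \<Rightarrow> bool" where
  "has_Z2_torsion G \<longleftrightarrow> (\<exists>x \<in> carrier G. group.ord G x = 2)"

end

theory Submission
  imports Defs "HOL-Library.Disjoint_Sets" "HOL-Library.Z2"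
begin

text \<open>
  In the extreme degrees of the theorem, the Khovanov complex is an incidence complex of the state
  graph \<open>G\<close>, because changing a marker of an adequate state merges two circles.

  For \<open>s\<^sub>+\<close>, the chain groups are freely generated by the vertices \<open>v\<close> (the circle \<open>v\<close> is negative),
  by the edges \<open>c\<close> (the marker of \<open>c\<close> is negative, all circles are positive) and by certain pairs of
  parallel edges.  The differentials send \<open>v\<close> to the sum of the edges at \<open>v\<close>, and \<open>\<Sum>\<^sub>c y\<^sub>c c\<close> to the
  chain with coefficient \<open>y\<^sub>a - y\<^sub>b\<close> at \<open>{a, b}\<close>.  The sum \<open>z\<close> of all edges is a cycle and \<open>2 z\<close> is
  the boundary of the sum of all vertices.  If \<open>z\<close> were a boundary, there would be an integral
  function on the vertices with \<open>f u + f v = 1\<close> for every edge \<open>uv\<close>, and an odd cycle would force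
  \<open>2 f v = 1\<close>.

  For \<open>s\<^sub>-\<close>, the homology is the quotient of the free abelian group on the vertices (the circle \<open>v\<close> is
  positive) by the relations \<open>u + v = 0\<close> for the edges \<open>uv\<close>.  Going around an odd cycle gives
  \<open>2 v = 0\<close>, and \<open>v \<noteq> 0\<close> since all relations have an even coefficient sum.
\<close>

section \<open>Torsion in the homology of the complex\<close>

text \<open>The coset of \<open>x\<close> is nontrivial and its square is trivial, so its order
  divides 2 and differs from 1.\<close>

lemma has_Z2_torsion_Mod:
  assumes "I \<lhd> G" and x: "x \<in> carrier G" "x \<notin> I" "x \<otimes>\<^bsub>G\<^esub> x \<in> I"
  shows "has_Z2_torsion (G Mod I)"
proof -
  interpret normal I G by fact
  interpret Q: group "G Mod I" by (rule factorgroup_is_group)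
  let ?x = "I #>\<^bsub>G\<^esub> x"
  have mem: "?x \<in> carrier (G Mod I)"
    using x by (auto simp: carrier_FactGroup)
  have "?x [^]\<^bsub>G Mod I\<^esub> (2::nat) = I #>\<^bsub>G\<^esub> (x \<otimes>\<^bsub>G\<^esub> x)"
    using x FactGroup_pow[of x 2] by (simp add: numeral_2_eq_2)
  also have "\<dots> = \<one>\<^bsub>G Mod I\<^esub>"
    using x rcos_const[OF is_group] by simp
  finally have "Q.ord ?x dvd 2"
    using mem Q.pow_eq_id by blast
  moreover have "?x \<noteq> \<one>\<^bsub>G Mod I\<^esub>"
    using x rcos_self[OF _ is_subgroup] by fastforce
  then have "Q.ord ?x \<noteq> 1"
    using mem Q.ord_eq_1 by blast
  ultimately have "Q.ord ?x = 2"
    using dvd_imp_le[of "Q.ord ?x" 2] by (auto simp: le_less_Suc_eq numeral_2_eq_2 le_Suc_eq)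
  then show ?thesis
    using mem unfolding has_Z2_torsion_def by blast
qed

lemma differential_keys: "Poly_Mapping.keys (differential D i j x) \<subseteq> generators D (i - 2) j"
proof -
  have "Poly_Mapping.keys (differential D i j x) \<subseteq>
    (\<Union>S\<in>Poly_Mapping.keys x. Poly_Mapping.keys (\<Sum>S' \<in> generators D (i - 2) j.
     frag_cmul ((- 1) ^ incidence_exponent D S S' * incidence D S S') (frag_of S')))"
    unfolding differential_def by (rule keys_frag_extend)
  also have "\<dots> \<subseteq> generators D (i - 2) j"
  proof (rule UN_least)
    fix S
    show "Poly_Mapping.keys (\<Sum>S' \<in> generators D (i - 2) j.
     frag_cmul ((- 1) ^ incidence_exponent D S S' * incidence D S S') (frag_of S')) \<subseteq> generators D (i - 2) j"
      by (rule order.trans[OF keys_sum]) auto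
  qed
  finally show ?thesis .
qed

lemma differential_add: "differential D i j (x + y) = differential D i j x + differential D i j y"
  unfolding differential_def by (rule frag_extend_add)

lemma differential_hom:
  "differential D i j \<in> hom (chain_group D i j) (chain_group D (i - 2) j)"
  using differential_keys by (auto simp: hom_def chain_group_def differential_add)

text \<open>The class of the cycle \<open>z\<close> has order 2: its double bounds \<open>w\<close>,
  and no \<open>u\<close> bounds it. Hypothesis \<open>dd\<close> places the boundaries inside the
  cycles, so that the quotient is one of groups; each application checks it from its own explicit
  formulas.\<close>

lemma khovanov_Z2_torsionI:
  assumes dd: "\<And>x. Poly_Mapping.keys x \<subseteq> generators D (i + 2) j \<Longrightarrow>
      differential D i j (differential D (i + 2) j x) = 0"
    and z: "Poly_Mapping.keys z \<subseteq> generators D i j" "differential D i j z = 0"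
    and w: "Poly_Mapping.keys w \<subseteq> generators D (i + 2) j" "z + z = differential D (i + 2) j w"
    and u: "\<And>u. Poly_Mapping.keys u \<subseteq> generators D (i + 2) j \<Longrightarrow> z \<noteq> differential D (i + 2) j u"
  shows "has_Z2_torsion (khovanov_homology D i j)"
proof -
  let ?C = "chain_group D i j"
  let ?K = "kernel ?C (chain_group D (i - 2) j) (differential D i j)"
  let ?I = "differential D (i + 2) j ` carrier (chain_group D (i + 2) j)"
  let ?G = "subgroup_generated ?C ?K"
  have grp: "group (chain_group D i j)" for i
    by (simp add: chain_group_def)
  interpret d: group_hom ?C "chain_group D (i - 2) j" "differential D i j"
    using grp differential_hom by (simp add: group_hom_def group_hom_axioms_def)
  interpret e: group_hom "chain_group D (i + 2) j" ?C "differential D (i + 2) j"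
    using grp differential_hom[of D "i + 2" j] by (simp add: group_hom_def group_hom_axioms_def)
  have carr: "carrier ?G = ?K"
    by (rule subgroup.carrier_subgroup_generated_subgroup[OF d.subgroup_kernel])
  have "?I \<subseteq> ?K"
  proof
    fix y assume y: "y \<in> ?I"
    then have "y \<in> carrier ?C" by auto
    moreover have "differential D i j y = 0"
      using y dd by (auto simp: chain_group_def)
    ultimately show "y \<in> ?K"
      by (simp add: kernel_def chain_group_def)
  qed
  then have "subgroup ?I ?G"
    using e.img_is_subgroup by (intro group.subgroup_of_subgroup_generated[OF grp])
  moreover have "comm_group ?G"
    by (rule group.abelian_subgroup_generated[OF grp]) (simp add: chain_group_def abelian_free_Abelian_group)
  ultimately have "?I \<lhd> ?G"
    by (rule_tac comm_group.subgroup_imp_normal)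
  moreover have "z \<in> carrier ?G"
    unfolding carr using z by (simp add: kernel_def chain_group_def)
  moreover have "z \<notin> ?I"
  proof
    assume "z \<in> ?I"
    then obtain v where "v \<in> carrier (chain_group D (i + 2) j)" "z = differential D (i + 2) j v"
      by (rule imageE)
    then show False
      using u[of v] by (simp add: chain_group_def)
  qed
  moreover have "z \<otimes>\<^bsub>?G\<^esub> z \<in> ?I"
    using w by (auto simp: chain_group_def)
  ultimately show ?thesis
    unfolding khovanov_homology_def by (rule has_Z2_torsion_Mod)
qed

section \<open>Matrix entries of the differential\<close>

definition coef :: "diagram \<Rightarrow> enhanced_state \<Rightarrow> enhanced_state \<Rightarrow> int" where
  "coef D S S' = (- 1) ^ incidence_exponent D S S' * incidence D S S'"

text \<open>This is the matrix-vector product. Summing over all generators instead of the keys of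
  \<open>x\<close> allows reindexing by vertices or edges of the state graph.\<close>

lemma lookup_differential:
  assumes fin: "finite (generators D i j)" "finite (generators D (i - 2) j)"
    and x: "Poly_Mapping.keys x \<subseteq> generators D i j"
  shows "Poly_Mapping.lookup (differential D i j x) S' =
    (if S' \<in> generators D (i - 2) j
     then \<Sum>S \<in> generators D i j. Poly_Mapping.lookup x S * coef D S S' else 0)"
proof -
  have inner: "Poly_Mapping.lookup (\<Sum>S' \<in> generators D (i - 2) j. frag_cmul (coef D S S') (frag_of S')) S'
      = (if S' \<in> generators D (i - 2) j then coef D S S' else 0)" for S
    using fin by (simp add: lookup_sum if_distrib[of "\<lambda>x. _ * x"] cong: if_cong)
  have "Poly_Mapping.lookup (differential D i j x) S' =
    (\<Sum>S \<in> Poly_Mapping.keys x. Poly_Mapping.lookup x S * (if S' \<in> generators D (i - 2) j then coef D S S' else 0))"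
    unfolding differential_def frag_extend_def coef_def[symmetric]
    unfolding lookup_sum[where X = "Poly_Mapping.keys x"] lookup_frag_cmul inner ..
  also have "\<dots> = (\<Sum>S \<in> generators D i j. Poly_Mapping.lookup x S * (if S' \<in> generators D (i - 2) j then coef D S S' else 0))"
    using fin x by (intro sum.mono_neutral_left) (auto simp: in_keys_iff)
  finally show ?thesis by simp
qed

lemma lookup_sum_frag_of:
  assumes "finite A"
  shows "Poly_Mapping.lookup (\<Sum>a\<in>A. frag_of a) x = (if x \<in> A then 1 else 0)"
  using assms by (induction A) (auto simp: lookup_add lookup_frag_of)

section \<open>Circles under a change of marker\<close>

definition trail :: "('a \<Rightarrow> 'a) set \<Rightarrow> 'a \<Rightarrow> 'a set" where
  "trail F x = {(y, f y) | y f. f \<in> F}\<^sup>* `` {x}"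

lemma orbits_eq_trail: "orbits A F = trail F ` A"
  by (simp add: orbits_def trail_def)

lemma trail_refl: "x \<in> trail F x"
  by (simp add: trail_def)

lemma trail_closed: "y \<in> trail F x \<Longrightarrow> f \<in> F \<Longrightarrow> f y \<in> trail F x"
  unfolding trail_def by (simp, erule rtrancl_into_rtrancl) blast

lemma trail_least:
  assumes "x \<in> W" "\<And>y f. y \<in> W \<Longrightarrow> f \<in> F \<Longrightarrow> f y \<in> W"
  shows "trail F x \<subseteq> W"
proof
  fix z assume "z \<in> trail F x"
  then have "(x, z) \<in> {(y, f y) | y f. f \<in> F}\<^sup>*" by (simp add: trail_def)
  then show "z \<in> W" by induction (use assms in auto)
qed

lemma trail_mono: "y \<in> trail F x \<Longrightarrow> trail F y \<subseteq> trail F x"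
  by (rule trail_least) (auto intro: trail_closed)

text \<open>Since each map undoes itself, forward reachability is symmetric, and trails are
  equivalence classes.\<close>

lemma trail_eq:
  assumes inv: "\<And>f a. f \<in> F \<Longrightarrow> a \<in> A \<Longrightarrow> f a \<in> A \<and> f (f a) = a"
    and x: "x \<in> A" and y: "y \<in> trail F x"
  shows "trail F y = trail F x"
proof
  \<comment> \<open>The points of \<open>A\<close> from which \<open>x\<close> can be reached are
    closed under \<open>F\<close>: a step to \<open>f y\<close> is reversed by applying
    \<open>f\<close> again.\<close>
  have "trail F x \<subseteq> {y \<in> A. x \<in> trail F y}"
  proof (rule trail_least)
    fix y f assume y: "y \<in> {y \<in> A. x \<in> trail F y}" and f: "f \<in> F"
    have "f y \<in> A" "f (f y) = y"
      using inv[OF f, of y] y by auto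
    moreover from this have "y \<in> trail F (f y)"
      using trail_closed[OF trail_refl f, of "f y"] by simp
    then have "trail F y \<subseteq> trail F (f y)"
      by (rule trail_mono)
    ultimately show "f y \<in> {y \<in> A. x \<in> trail F y}"
      using y by auto
  qed (simp add: x trail_refl)
  then show "trail F x \<subseteq> trail F y"
    using y by (auto dest: trail_mono)
qed (rule trail_mono[OF y])

text \<open>The involution pairs off the points of \<open>X\<close>, so the sum of ones over
  \<open>X\<close> vanishes in characteristic 2.\<close>

lemma even_card_involution:
  assumes "\<And>x. x \<in> X \<Longrightarrow> h x \<in> X" "\<And>x. x \<in> X \<Longrightarrow> h (h x) = x" "\<And>x. x \<in> X \<Longrightarrow> h x \<noteq> x"
  shows "even (card X)"
proof -
  have "(\<Sum>x\<in>X. 1 :: bit) = 0"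
    by (rule sum_involution_eq_0[of X _ h]) (use assms in auto)
  then have "of_nat (card X) = (0 :: bit)" by simp
  then show ?thesis by (metis even_of_nat_iff dvd_0_right)
qed

definition touching :: "diagram \<Rightarrow> kauffman_state \<Rightarrow> nat \<Rightarrow> circle set" where
  "touching D s c = {C \<in> circles D s. touches C c}"

lemma finite_darts: "finite (darts D)"
  by (simp add: darts_def)

lemma finite_circles: "finite (circles D s)"
  by (simp add: circles_def orbits_eq_trail finite_darts)

lemma finite_touching: "finite (touching D s c)"
  by (simp add: touching_def finite_circles)

lemma darts_iff: "(c, k) \<in> darts D \<longleftrightarrow> c < num_crossings D \<and> (k = 0 \<or> k = 1 \<or> k = 2 \<or> k = 3)"
  by (auto simp: darts_def)

lemma smoothing_involution:
  assumes "d \<in> darts D"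
  shows "smoothing s d \<in> darts D" "smoothing s (smoothing s d) = d" "smoothing s d \<noteq> d"
proof -
  obtain c k where d: "d = (c, k)" by force
  show "smoothing s d \<in> darts D" "smoothing s (smoothing s d) = d" "smoothing s d \<noteq> d"
    using assms unfolding d darts_iff
    by (cases "s c"; auto simp: smoothing_def darts_iff)+
qed

lemma fst_smoothing: "fst (smoothing s d) = fst d"
  by (cases d) (simp add: smoothing_def)

lemma smoothing_cong: "s (fst d) = s' (fst d) \<Longrightarrow> smoothing s d = smoothing s' d"
  by (cases d) (simp add: smoothing_def)

section \<open>Circles of a state as orbits of two involutions, and their change under a marker
  flip\<close>

locale glued =
  fixes D :: diagram
  assumes glue_involution: "\<And>d. d \<in> darts D \<Longrightarrow> glue D d \<in> darts D"
    "\<And>d. d \<in> darts D \<Longrightarrow> glue D (glue D d) = d" "\<And>d. d \<in> darts D \<Longrightarrow> glue D d \<noteq> d"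
begin

abbreviation strand :: "kauffman_state \<Rightarrow> dart \<Rightarrow> dart set" where
  "strand s \<equiv> trail {glue D, smoothing s}"

lemma circles_eq: "circles D s = (Through \<circ> strand s) ` darts D \<union> Free ` {..<free_circles D}"
  by (simp add: circles_def orbits_eq_trail image_comp)

lemma strand_glue: "d \<in> strand s x \<Longrightarrow> glue D d \<in> strand s x"
  by (rule trail_closed[where f = "glue D"]) auto

lemma strand_smoothing: "d \<in> strand s x \<Longrightarrow> smoothing s d \<in> strand s x"
  by (rule trail_closed[where f = "smoothing s"]) auto

lemma strand_subset: "x \<in> darts D \<Longrightarrow> strand s x \<subseteq> darts D"
  by (rule trail_least) (auto simp: glue_involution smoothing_involution)

lemma strand_eq: "x \<in> darts D \<Longrightarrow> y \<in> strand s x \<Longrightarrow> strand s y = strand s x"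
  by (rule trail_eq[where A = "darts D"]) (auto simp: glue_involution smoothing_involution)

lemma strand_in_circles: "x \<in> darts D \<Longrightarrow> Through (strand s x) \<in> circles D s"
  unfolding circles_eq by simp

lemma strand_in_touching:
  assumes "(c, k) \<in> darts D"
  shows "Through (strand s (c, k)) \<in> touching D s c"
  unfolding touching_def
  using strand_in_circles[OF assms, of s] trail_refl[of "(c, k)" "{glue D, smoothing s}"] by auto

text \<open>Under either marker, one of the ends 1 and 3 is joined to end 0 and the other to end 2.
  Hence ends 0 and 2 represent the two arcs at \<open>c\<close> for every state.\<close>

lemma touching_eq:
  assumes c: "c < num_crossings D"
  shows "touching D s c = {Through (strand s (c, 0)), Through (strand s (c, 2))}"
proof
  show "{Through (strand s (c, 0)), Through (strand s (c, 2))} \<subseteq> touching D s c"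
    using c by (simp add: strand_in_touching darts_iff)
  show "touching D s c \<subseteq> {Through (strand s (c, 0)), Through (strand s (c, 2))}"
  proof
    fix C assume "C \<in> touching D s c"
    then obtain x k where x: "x \<in> darts D" "C = Through (strand s x)" "(c, k) \<in> strand s x"
      by (auto simp: touching_def circles_eq)
    have k: "(c, k) \<in> darts D"
      using strand_subset[OF x(1), of s] x(3) by blast
    have C: "C = Through (strand s (c, k))"
      using strand_eq[OF x(1,3)] x(2) by simp
    let ?d = "smoothing s (c, k)"
    have "strand s ?d = strand s (c, k)"
      by (rule strand_eq[OF k strand_smoothing[OF trail_refl]])
    moreover have "k = 0 \<or> k = 2 \<or> ?d = (c, 0) \<or> ?d = (c, 2)"
      using k by (cases "s c") (auto simp: darts_iff smoothing_def)
    ultimately show "C \<in> {Through (strand s (c, 0)), Through (strand s (c, 2))}"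
      unfolding C by (metis insert_iff)
  qed
qed

text \<open>A strand depends only on the markers at the crossings it visits.\<close>

lemma strand_cong:
  assumes "\<And>b k. (b, k) \<in> strand s x \<Longrightarrow> s b = s' b"
  shows "strand s' x = strand s x"
proof -
  have sub: "strand s' x \<subseteq> strand s x"
  proof (rule trail_least)
    fix y f assume "y \<in> strand s x" "f \<in> {glue D, smoothing s'}"
    then show "f y \<in> strand s x"
      using assms[of "fst y" "snd y"] smoothing_cong[of s y s'] strand_glue[of y s x] strand_smoothing[of y s x]
      by auto
  qed (rule trail_refl)
  moreover have "strand s x \<subseteq> strand s' x"
  proof -
    \<comment> \<open>Closure is shown for the intersection because a bare point of
      \<open>strand s' x\<close> is not known to lie at a crossing where the states agree.\<close>
    have "strand s x \<subseteq> strand s x \<inter> strand s' x"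
    proof (rule trail_least)
      fix y f assume "y \<in> strand s x \<inter> strand s' x" "f \<in> {glue D, smoothing s}"
      then show "f y \<in> strand s x \<inter> strand s' x"
        using assms[of "fst y" "snd y"] smoothing_cong[of s y s'] 
          strand_glue[of y s x] strand_glue[of y s' x] strand_smoothing[of y s x] strand_smoothing[of y s' x] by auto
    qed (simp add: trail_refl)
    then show ?thesis by simp
  qed
  ultimately show ?thesis by blast
qed

lemma circles_not_touching:
  assumes "\<And>b. b \<noteq> c \<Longrightarrow> s b = s' b" "C \<in> circles D s" "\<not> touches C c"
  shows "C \<in> circles D s'"
proof (cases C)
  case (Through X)
  then obtain x where x: "x \<in> darts D" "X = strand s x"
    using assms by (auto simp: circles_eq)
  have "strand s' x = strand s x"
  proof (rule strand_cong)
    fix b k assume "(b, k) \<in> strand s x"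
    then have "b \<noteq> c" using assms(3) Through x by auto
    then show "s b = s' b" by (rule assms(1))
  qed
  then show ?thesis
    using x Through by (auto simp: circles_eq)
qed (use assms in \<open>auto simp: circles_eq\<close>)

text \<open>
  If the two strands at \<open>c\<close> did not merge, the darts common to the old and the new strand through
  \<open>(c, 0)\<close> would be paired off by \<open>glue\<close>, and those other than \<open>(c, 0)\<close> also by the smoothing.
\<close>

lemma strands_merge:
  assumes c: "c < num_crossings D" and flip: "s c \<noteq> s' c" "\<And>b. b \<noteq> c \<Longrightarrow> s b = s' b"
    and neq: "strand s (c, 0) \<noteq> strand s (c, 2)"
  shows "strand s' (c, 0) = strand s' (c, 2)"
proof -
  let ?A = "strand s (c, 0)" and ?O = "strand s' (c, 0)"
  let ?W = "?A \<inter> ?O"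
  have darts: "(c, k) \<in> darts D" if "k < 4" for k
    using c that by (simp add: darts_def)
  have A: "(c, 2) \<notin> ?A"
    using strand_eq[OF darts[of 0], of "(c, 2)" s] neq by auto
  have "(c, 2) \<in> ?O"
  proof (rule ccontr)
    assume O: "(c, 2) \<notin> ?O"
    \<comment> \<open>One of the two smoothings joins end 1 to end 2, and the other joins end 3 to
      end 2. As neither strand contains \<open>(c, 2)\<close>, neither of the ends 1 and 3 can lie
      on both strands.\<close>
    have only: "d = (c, 0)" if "d \<in> ?W" "fst d = c" for d
    proof -
      obtain k where d: "d = (c, k)" using \<open>fst d = c\<close> by (metis prod.collapse)
      then have "(c, k) \<in> darts D"
        using that strand_subset[OF darts[of 0], of s] by auto
      then have k: "k = 0 \<or> k = 1 \<or> k = 2 \<or> k = 3"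
        by (simp add: darts_iff)
      show ?thesis
        using k d that A O flip(1) strand_smoothing[of d s "(c, 0)"] strand_smoothing[of d s' "(c, 0)"]
        by (cases "s c"; cases "s' c") (auto simp: smoothing_def)
    qed
    have sub: "?W \<subseteq> darts D" using strand_subset[OF darts[of 0], of s] by auto
    have "even (card ?W)"
    proof (rule even_card_involution[of _ "glue D"])
      fix d assume "d \<in> ?W"
      then show "glue D d \<in> ?W" by (simp add: strand_glue)
    qed (use sub glue_involution in auto)
    moreover have "even (card (?W - {(c, 0)}))"
    proof (rule even_card_involution[of _ "smoothing s"])
      fix d assume d: "d \<in> ?W - {(c, 0)}"
      then have "fst d \<noteq> c" using only by blast
      then have "smoothing s d = smoothing s' d" "fst (smoothing s d) \<noteq> c"
        using flip(2) by (auto intro: smoothing_cong simp: fst_smoothing)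
      then show "smoothing s d \<in> ?W - {(c, 0)}"
        using d strand_smoothing[of d s "(c, 0)"] strand_smoothing[of d s' "(c, 0)"] by auto
    qed (use sub smoothing_involution in auto)
    moreover have "(c, 0) \<in> ?W" "finite ?W"
      using sub finite_darts by (auto intro: trail_refl finite_subset)
    then have "card ?W = Suc (card (?W - {(c, 0)}))"
      by (metis card.remove)
    ultimately show False by simp
  qed
  then show ?thesis
    using strand_eq[OF darts[of 0], of "(c, 2)" s'] by simp
qed

lemma card_touching:
  assumes "c < num_crossings D"
  shows "card (touching D s c) = (if strand s (c, 0) = strand s (c, 2) then 1 else 2)"
  using touching_eq[OF assms, of s] by simp

text \<open>The circles missing \<open>c\<close> are literally the same sets for both states, so the
  counts can differ only through the circles at \<open>c\<close>.\<close>

lemma card_circles_flip: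
  assumes "\<And>b. b \<noteq> c \<Longrightarrow> s b = s' b"
  shows "card (circles D s) + card (touching D s' c) = card (circles D s') + card (touching D s c)"
proof -
  have split: "card (circles D t) = card (touching D t c) + card {C \<in> circles D t. \<not> touches C c}" for t
  proof -
    have "card (circles D t) = card (touching D t c \<union> {C \<in> circles D t. \<not> touches C c})"
      by (rule arg_cong[of _ _ card]) (auto simp: touching_def)
    also have "\<dots> = card (touching D t c) + card {C \<in> circles D t. \<not> touches C c}"
      by (rule card_Un_disjoint) (auto simp: touching_def finite_circles)
    finally show ?thesis .
  qed
  have "{C \<in> circles D s. \<not> touches C c} = {C \<in> circles D s'. \<not> touches C c}"
    using circles_not_touching[of c s s'] circles_not_touching[of c s' s] assms by (auto simp: eq_commute)
  then show ?thesis
    using split[of s] split[of s'] by simp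
qed

lemma flip_merge:
  assumes "c < num_crossings D" "s c \<noteq> s' c" "\<And>b. b \<noteq> c \<Longrightarrow> s b = s' b"
    and "card (touching D s c) = 2"
  shows "card (touching D s' c) = 1" "card (circles D s) = Suc (card (circles D s'))"
proof -
  show 1: "card (touching D s' c) = 1"
    using assms strands_merge[of c s s'] by (simp add: card_touching split: if_splits)
  show "card (circles D s) = Suc (card (circles D s'))"
    using card_circles_flip[of c s s'] assms 1 by simp
qed

text \<open>Each state has one or two circles at \<open>c\<close>, so a flip creates at most one
  more.\<close>

lemma flip_card_le:
  assumes "c < num_crossings D" "\<And>b. b \<noteq> c \<Longrightarrow> s b = s' b"
  shows "card (circles D s') \<le> Suc (card (circles D s))"
  using card_circles_flip[of c s s'] assms by (simp add: card_touching split: if_splits)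

end

text \<open>Adding and subtracting the edge relations alternately around the cycle telescopes to
  twice the value at the start. The set \<open>I\<close> plays the role of a subgroup, so that the
  lemma covers both equations over the integers (\<open>I = {0}\<close>) and relations modulo
  boundaries.\<close>

lemma odd_cycle_double:
  fixes g :: "'v \<Rightarrow> 'a :: ab_group_add"
  assumes cyc: "is_cycle G vs es" "odd (length es)"
    and I: "0 \<in> I" "\<And>x y. x \<in> I \<Longrightarrow> y \<in> I \<Longrightarrow> x + y \<in> I" "\<And>x y. x \<in> I \<Longrightarrow> y \<in> I \<Longrightarrow> x - y \<in> I"
    and edge: "\<And>e a b. e \<in> edges G \<Longrightarrow> ends G e = {a, b} \<Longrightarrow> g a + g b \<in> I"
  shows "g (vs ! 0) + g (vs ! 0) \<in> I"
proof -
  let ?n = "length vs"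
  have n: "?n > 0" "odd ?n" "length es = ?n" using cyc by (auto simp: is_cycle_def)
  have step: "g (vs ! i) + g (vs ! (Suc i mod ?n)) \<in> I" if "i < ?n" for i
    using cyc n that by (intro edge[of "es ! i"]) (auto simp: is_cycle_def)
  have alt: "(if even i then g (vs ! 0) - g (vs ! i) else g (vs ! 0) + g (vs ! i)) \<in> I" if "i < ?n" for i
    using that
  proof (induction i)
    case (Suc i)
    then have e: "g (vs ! i) + g (vs ! Suc i) \<in> I"
      using step[of i] by simp
    show ?case
    proof (cases "even i")
      case True
      then have "(g (vs ! 0) - g (vs ! i)) + (g (vs ! i) + g (vs ! Suc i)) \<in> I"
        using I(2)[OF _ e, of "g (vs ! 0) - g (vs ! i)"] Suc True by auto
      then show ?thesis using True by (simp add: algebra_simps)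
    next
      case False
      then have "(g (vs ! 0) + g (vs ! i)) - (g (vs ! i) + g (vs ! Suc i)) \<in> I"
        using I(3)[OF _ e, of "g (vs ! 0) + g (vs ! i)"] Suc False by auto
      then show ?thesis using False by (simp add: algebra_simps)
    qed
  qed (use I in auto)
  \<comment> \<open>The last index is even because the length is odd, so \<open>alt\<close> gives a
    difference there, and the closing edge turns it into a sum.\<close>
  have "(g (vs ! 0) - g (vs ! (?n - 1))) + (g (vs ! (?n - 1)) + g (vs ! 0)) \<in> I"
    using I(2)[of "g (vs ! 0) - g (vs ! (?n - 1))" "g (vs ! (?n - 1)) + g (vs ! 0)"]
      alt[of "?n - 1"] step[of "?n - 1"] n by auto
  then show ?thesis by simp
qed

section \<open>Generators and incidence numbers\<close>

text \<open>A sign function is encoded by its set of negative points. Restriction to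
  \<open>A\<close> makes it extensional, so that different subsets of \<open>A\<close> correspond
  exactly to the elements of the function space.\<close>

definition signing :: "'a set \<Rightarrow> 'a set \<Rightarrow> 'a \<Rightarrow> sign" where
  "signing A M = (\<lambda>x\<in>A. if x \<in> M then Negative else Positive)"

lemma signing_apply: "x \<in> A \<Longrightarrow> signing A M x = (if x \<in> M then Negative else Positive)"
  by (simp add: signing_def)

lemma signing_eq_iff: "M \<subseteq> A \<Longrightarrow> M' \<subseteq> A \<Longrightarrow> signing A M = signing A M' \<longleftrightarrow> M = M'"
proof
  assume sub: "M \<subseteq> A" "M' \<subseteq> A" and eq: "signing A M = signing A M'"
  have "x \<in> M \<longleftrightarrow> x \<in> M'" if "x \<in> A" for x
    using fun_cong[OF eq, of x] that by (simp add: signing_apply split: if_splits)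
  then show "M = M'" using sub by blast
qed simp

lemma PiE_sign_eq: "(A \<rightarrow>\<^sub>E (UNIV :: sign set)) = signing A ` Pow A"
proof
  show "(A \<rightarrow>\<^sub>E UNIV) \<subseteq> signing A ` Pow A"
  proof
    fix f :: "'a \<Rightarrow> sign" assume f: "f \<in> A \<rightarrow>\<^sub>E UNIV"
    have "f = signing A {x \<in> A. f x = Negative}"
    proof
      fix x show "f x = signing A {x \<in> A. f x = Negative} x"
        using f by (cases "f x") (auto simp: signing_def PiE_def extensional_def)
    qed
    then show "f \<in> signing A ` Pow A" by blast
  qed
qed (auto simp: signing_def)

text \<open>
  \<open>M\<close> is the set of crossings with a negative marker and \<open>P\<close> the set of negative circles.
\<close>

definition marking :: "diagram \<Rightarrow> nat set \<Rightarrow> kauffman_state" where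
  "marking D M = signing {..<num_crossings D} M"

definition enhanced :: "diagram \<Rightarrow> nat set \<Rightarrow> circle set \<Rightarrow> enhanced_state" where
  "enhanced D M P = (marking D M, signing (circles D (marking D M)) P)"

lemma s_plus_eq: "s_plus D = marking D {}"
  by (simp add: s_plus_def marking_def signing_def)

lemma s_minus_eq: "s_minus D = marking D {..<num_crossings D}"
  by (auto simp: s_minus_def marking_def signing_def)

lemma marking_insert: "b \<noteq> c \<Longrightarrow> marking D M b = marking D (insert c M) b"
  by (simp add: marking_def signing_def)

lemma marking_insert_neq: "c < num_crossings D \<Longrightarrow> c \<notin> M \<Longrightarrow> marking D M c \<noteq> marking D (insert c M) c"
  by (simp add: marking_def signing_def)

lemma enhanced_eq_iff:
  assumes "M \<subseteq> {..<num_crossings D}" "P \<subseteq> circles D (marking D M)"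
    "M' \<subseteq> {..<num_crossings D}" "P' \<subseteq> circles D (marking D M')"
  shows "enhanced D M P = enhanced D M' P' \<longleftrightarrow> M = M' \<and> P = P'"
proof
  assume eq: "enhanced D M P = enhanced D M' P'"
  then have "M = M'"
    using assms by (simp add: enhanced_def marking_def signing_eq_iff)
  then show "M = M' \<and> P = P'"
    using eq assms by (simp add: enhanced_def signing_eq_iff)
qed simp

lemma enhanced_states_eq:
  "enhanced_states D =
    {enhanced D M P | M P. M \<subseteq> {..<num_crossings D} \<and> P \<subseteq> circles D (marking D M)}"
  unfolding enhanced_states_def states_def PiE_sign_eq enhanced_def marking_def by blast

lemma card_sign_split:
  assumes "finite A" "M \<subseteq> A"
  shows "int (card {x \<in> A. signing A M x = Positive}) - int (card {x \<in> A. signing A M x = Negative})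
    = int (card A) - 2 * int (card M)"
proof -
  have "{x \<in> A. signing A M x = Positive} = A - M" "{x \<in> A. signing A M x = Negative} = M"
    using assms by (auto simp: signing_apply split: if_splits)
  moreover have "card (A - M) = card A - card M" "card M \<le> card A"
    using assms by (auto intro: card_Diff_subset card_mono finite_subset)
  ultimately show ?thesis by simp
qed

lemma sigma_marking:
  assumes "M \<subseteq> {..<num_crossings D}"
  shows "sigma D (marking D M) = int (num_crossings D) - 2 * int (card M)"
  using card_sign_split[OF _ assms] by (simp add: sigma_def marking_def)

lemma tau_enhanced:
  assumes "P \<subseteq> circles D (marking D M)"
  shows "tau D (enhanced D M P) = int (card (circles D (marking D M))) - 2 * int (card P)"
  using card_sign_split[OF finite_circles assms] by (simp add: tau_def enhanced_def)

text \<open>The bidegree becomes two linear equations in the numbers of negative markers, of circles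
  and of negative circles; the extreme degrees are found by solving them.\<close>

lemma generators_eq:
  "generators D i j = {enhanced D M P | M P. M \<subseteq> {..<num_crossings D} \<and> P \<subseteq> circles D (marking D M)
     \<and> i = int (num_crossings D) - 2 * int (card M)
     \<and> j = i + 2 * (int (card (circles D (marking D M))) - 2 * int (card P))}"
proof -
  have fst: "fst (enhanced D M P) = marking D M" for M P by (simp add: enhanced_def)
  show ?thesis
    unfolding generators_def enhanced_states_eq
    by (auto simp: fst sigma_marking tau_enhanced; metis sigma_marking tau_enhanced fst)
qed

lemma enhanced_in_generators:
  assumes "M \<subseteq> {..<num_crossings D}" "P \<subseteq> circles D (marking D M)"
    "i = int (num_crossings D) - 2 * int (card M)"
    "j = i + 2 * (int (card (circles D (marking D M))) - 2 * int (card P))"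
  shows "enhanced D M P \<in> generators D i j"
  unfolding generators_eq using assms by blast

lemma finite_generators: "finite (generators D i j)"
proof -
  have "finite (states D)" "\<And>s. finite (circles D s \<rightarrow>\<^sub>E (UNIV :: sign set))"
    unfolding states_def PiE_sign_eq by (simp_all add: finite_circles)
  then have "finite (enhanced_states D)"
    unfolding enhanced_states_def by blast
  then show ?thesis
    by (rule rev_finite_subset) (auto simp: generators_def)
qed

lemma differing_enhanced:
  assumes "M \<subseteq> {..<num_crossings D}" "M' \<subseteq> {..<num_crossings D}"
  shows "differing D (enhanced D M P) (enhanced D M' P') = (M - M') \<union> (M' - M)"
  using assms by (auto simp: differing_def enhanced_def marking_def signing_apply split: if_splits)

lemma coef_eq_0: "\<nexists>v. differing D S S' = {v} \<Longrightarrow> coef D S S' = 0"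
  by (auto simp: coef_def incidence_def)

context glued
begin

lemma circles_marking_insert:
  "\<not> touches C c \<Longrightarrow> C \<in> circles D (marking D M) \<longleftrightarrow> C \<in> circles D (marking D (insert c M))"
  using circles_not_touching[of c "marking D M" "marking D (insert c M)" C]
    circles_not_touching[of c "marking D (insert c M)" "marking D M" C] marking_insert[of _ c D M]
  by metis

text \<open>The negative markers counted by the exponent are the elements of \<open>M\<close> beyond
  \<open>c\<close>. Circles missing \<open>c\<close> survive the flip, so the sign condition can be
  read off from the circles of the first state alone.\<close>

lemma coef_insert:
  assumes "insert c M \<subseteq> {..<num_crossings D}" "c \<notin> M"
  shows "coef D (enhanced D M P) (enhanced D (insert c M) P') = (- 1) ^ card {b \<in> M. c < b} *
    (if \<forall>C \<in> circles D (marking D M). \<not> touches C c \<longrightarrow> (C \<in> P \<longleftrightarrow> C \<in> P') then 1 else 0)"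
proof -
  have diff: "differing D (enhanced D M P) (enhanced D (insert c M) P') = {c}"
    using assms by (subst differing_enhanced) auto
  have "{b. b < num_crossings D \<and> c < b \<and> fst (enhanced D M P) b = Negative} = {b \<in> M. c < b}"
    using assms by (auto simp: enhanced_def marking_def signing_apply split: if_splits)
  then have "incidence_exponent D (enhanced D M P) (enhanced D (insert c M) P') = card {b \<in> M. c < b}"
    by (simp add: incidence_exponent_def diff)
  moreover have "snd (enhanced D M P) C = snd (enhanced D (insert c M) P') C \<longleftrightarrow> (C \<in> P \<longleftrightarrow> C \<in> P')"
    if "C \<in> circles D (marking D M) \<inter> circles D (marking D (insert c M))" for C
    using that by (simp add: enhanced_def signing_apply)
  then have "(\<forall>C \<in> circles D (fst (enhanced D M P)) \<inter> circles D (fst (enhanced D (insert c M) P')).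
        \<not> touches C c \<longrightarrow> snd (enhanced D M P) C = snd (enhanced D (insert c M) P') C) \<longleftrightarrow>
      (\<forall>C \<in> circles D (marking D M). \<not> touches C c \<longrightarrow> (C \<in> P \<longleftrightarrow> C \<in> P'))"
    using circles_marking_insert[of _ c M] by (auto simp: enhanced_def)
  ultimately show ?thesis
    by (simp add: coef_def incidence_def diff)
qed

lemma ends_state_graph: "ends (state_graph D s) c = touching D s c"
  by (simp add: state_graph_def touching_def)

text \<open>A crossing meets one or two circles of a state, and looplessness excludes one.\<close>

lemma loopless_card_touching:
  assumes "loopless (state_graph D s)" "c < num_crossings D"
  shows "card (touching D s c) = 2"
proof -
  have "card (touching D s c) \<noteq> 1"
    using assms by (auto simp: loopless_def state_graph_def touching_def)
  then show ?thesis
    using card_touching[OF assms(2), of s] by metis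
qed

text \<open>The two arcs at \<open>b\<close> lie on different circles, so one of the ends 0 and 2 is
  off \<open>X\<close>. This will produce a second circle at \<open>b\<close> after another crossing
  has been flipped.\<close>

lemma other_dart:
  assumes b: "b < num_crossings D" "card (touching D s b) = 2" and X: "Through X \<in> touching D s b"
  obtains k where "(b, k) \<in> darts D" "(b, k) \<notin> X"
proof -
  have darts: "(b, 0) \<in> darts D" "(b, 2) \<in> darts D"
    using b by (simp_all add: darts_iff)
  have neq: "strand s (b, 0) \<noteq> strand s (b, 2)"
    using b card_touching[of b s] by (metis one_eq_numeral_iff semiring_norm(85))
  then have "(b, 2) \<notin> strand s (b, 0)" "(b, 0) \<notin> strand s (b, 2)"
    using strand_eq[OF darts(1), of "(b, 2)" s] strand_eq[OF darts(2), of "(b, 0)" s] by metis+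
  moreover have "X = strand s (b, 0) \<or> X = strand s (b, 2)"
    using X touching_eq[OF b(1), of s] by (metis circle.inject(1) empty_iff insert_iff)
  ultimately show ?thesis
    using that darts by metis
qed

end

section \<open>Diagrams that are adequate on one side\<close>

locale plus_adequate_diagram = glued +
  assumes card_touching_2: "\<And>c. c < num_crossings D \<Longrightarrow> card (touching D (marking D {}) c) = 2"
begin

abbreviation (input) "N \<equiv> num_crossings D"
abbreviation (input) "V \<equiv> circles D (marking D {})"
text \<open>The second degree of the all-positive state with exactly one negative circle: its
  \<open>sigma\<close> is \<open>N\<close> and its \<open>tau\<close> is
  \<open>card V - 2\<close>.\<close>

abbreviation (input) "J \<equiv> int N + 2 * int (card V) - 4"

lemma card_circles_one:
  assumes "c < N"
  shows "card V = Suc (card (circles D (marking D {c})))"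
  using assms flip_merge(2)[of c "marking D {}" "marking D {c}"] marking_insert[of _ c D "{}"]
    marking_insert_neq[of c D "{}"] card_touching_2[of c] by simp

text \<open>The flip at \<open>a\<close> merges two circles, and the flip at \<open>b\<close> can
  regain at most one. Regaining one excludes a merge at \<open>b\<close>, which forces both circles
  at \<open>b\<close> to meet \<open>a\<close> as well: the two edges are parallel.\<close>

lemma card_circles_two:
  assumes ab: "a < N" "b < N" "a \<noteq> b"
  shows "card (circles D (marking D {a, b})) \<le> card V"
    "card (circles D (marking D {a, b})) = card V \<Longrightarrow>
      touching D (marking D {}) a = touching D (marking D {}) b"
proof -
  let ?s = "marking D {a}" and ?s' = "marking D {a, b}"
  have ins: "{a, b} = insert b {a}" by auto
  have flip: "?s b \<noteq> ?s' b" "\<And>d. d \<noteq> b \<Longrightarrow> ?s d = ?s' d"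
    using ab marking_insert_neq[of b D "{a}"] marking_insert[of _ b D "{a}"] unfolding ins by auto
  show "card (circles D ?s') \<le> card V"
    using flip_card_le[of b ?s ?s'] card_circles_one[of a] ab flip by simp
  assume eq: "card (circles D ?s') = card V"
  have "touching D (marking D {}) b \<subseteq> touching D (marking D {}) a"
  proof
    fix A assume A: "A \<in> touching D (marking D {}) b"
    show "A \<in> touching D (marking D {}) a"
    proof (rule ccontr)
      assume "A \<notin> touching D (marking D {}) a"
      with A have nt: "\<not> touches A a" and t: "touches A b" and V: "A \<in> V"
        by (auto simp: touching_def)
      then have A': "A \<in> touching D ?s b"
        using circles_marking_insert[OF nt, of "{}"] by (simp add: touching_def)
      obtain X where X: "A = Through X" using t by (cases A) auto
      obtain k where k: "(b, k) \<in> darts D" "(b, k) \<notin> X"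
        using other_dart[OF ab(2) card_touching_2[OF ab(2)]] A X by blast
      \<comment> \<open>The circle \<open>A\<close> misses \<open>a\<close> and survives the flip at
        \<open>a\<close>. The circle \<open>?B\<close> through an end of \<open>b\<close> off
        \<open>A\<close> is a second one there, so the flip at \<open>b\<close> would merge again
        and leave too few circles.\<close>
      let ?B = "Through (strand ?s (b, k))"
      have "?B \<in> touching D ?s b" using strand_in_touching[OF k(1)] .
      moreover have "?B \<noteq> A" using k X trail_refl[of "(b, k)" "{glue D, smoothing ?s}"] by auto
      ultimately have "card {A, ?B} \<le> card (touching D ?s b)" "card {A, ?B} = 2"
        using A' card_mono[OF finite_touching, of "{A, ?B}" D ?s b] by auto
      then have "card (touching D ?s b) = 2"
        using card_touching[OF ab(2), of ?s] by (metis one_le_numeral le_antisym order_refl)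
      then show False
        using flip_merge(2)[of b ?s ?s', OF ab(2) flip] card_circles_one[OF ab(1)] eq by simp
    qed
  qed
  then have "touching D (marking D {}) b = touching D (marking D {}) a"
    using card_touching_2 ab
    by (intro card_subset_eq) (auto simp: touching_def finite_circles)
  then show "touching D (marking D {}) a = touching D (marking D {}) b" ..
qed

text \<open>The first degree forces all markers positive, and then the second leaves exactly one
  negative circle.\<close>

lemma generators_top: "generators D (int N) J = (\<lambda>v. enhanced D {} {v}) ` V"
proof
  show "generators D (int N) J \<subseteq> (\<lambda>v. enhanced D {} {v}) ` V"
  proof
    fix S assume "S \<in> generators D (int N) J"
    then obtain M P where S: "S = enhanced D M P" and M: "M \<subseteq> {..<N}"
      and P: "P \<subseteq> circles D (marking D M)" and i: "int N = int N - 2 * int (card M)"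
      and j: "J = int N + 2 * (int (card (circles D (marking D M))) - 2 * int (card P))"
      unfolding generators_eq by blast
    have "M = {}"
      using i finite_subset[OF M] by simp
    moreover from this have "card P = 1"
      using j by simp
    then obtain v where "P = {v}" by (rule card_1_singletonE)
    ultimately show "S \<in> (\<lambda>v. enhanced D {} {v}) ` V"
      using S P by auto
  qed
  show "(\<lambda>v. enhanced D {} {v}) ` V \<subseteq> generators D (int N) J"
    by (auto intro!: enhanced_in_generators)
qed

text \<open>A single negative marker costs one circle, which uses up the whole deficit in
  \<open>J\<close>; no negative circle is left.\<close>

lemma generators_middle: "generators D (int N - 2) J = (\<lambda>c. enhanced D {c} {}) ` {..<N}"
proof
  show "generators D (int N - 2) J \<subseteq> (\<lambda>c. enhanced D {c} {}) ` {..<N}"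
  proof
    fix S assume "S \<in> generators D (int N - 2) J"
    then obtain M P where S: "S = enhanced D M P" and M: "M \<subseteq> {..<N}"
      and P: "P \<subseteq> circles D (marking D M)" and i: "int N - 2 = int N - 2 * int (card M)"
      and j: "J = int N - 2 + 2 * (int (card (circles D (marking D M))) - 2 * int (card P))"
      unfolding generators_eq by blast
    have "card M = 1" using i by simp
    then obtain c where c: "M = {c}" by (rule card_1_singletonE)
    then have "card P = 0"
      using j card_circles_one[of c] M by simp
    then have "P = {}"
      using finite_subset[OF P finite_circles] by simp
    then show "S \<in> (\<lambda>c. enhanced D {c} {}) ` {..<N}"
      using S c M by auto
  qed
  show "(\<lambda>c. enhanced D {c} {}) ` {..<N} \<subseteq> generators D (int N - 2) J"
    using card_circles_one by (auto intro!: enhanced_in_generators)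
qed

text \<open>With \<open>k\<close> circles the second degree reads
  \<open>k - 2 * card P = card V\<close>. Since \<open>k\<close> is at most \<open>card V\<close>,
  this forces \<open>P = {}\<close> and \<open>k = card V\<close>, hence parallel edges.\<close>

lemma generators_bottom:
  assumes "S \<in> generators D (int N - 2 - 2) J"
  obtains a b where "a < b" "b < N" "S = enhanced D {a, b} {}"
    "touching D (marking D {}) a = touching D (marking D {}) b"
proof -
  obtain M P where S: "S = enhanced D M P" and M: "M \<subseteq> {..<N}"
    and P: "P \<subseteq> circles D (marking D M)" and i: "int N - 2 - 2 = int N - 2 * int (card M)"
    and j: "J = int N - 2 - 2 + 2 * (int (card (circles D (marking D M))) - 2 * int (card P))"
    using assms unfolding generators_eq by blast
  have "card M = 2" using i by simp
  then obtain x y where "M = {x, y}" "x \<noteq> y" by (auto simp: card_2_iff)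
  then obtain a b where ab: "M = {a, b}" "a < b"
    by (metis insert_commute linorder_neqE)
  then have lt: "a < N" "b < N" "a \<noteq> b" using M by auto
  have "card P = 0" and eq: "card (circles D (marking D {a, b})) = card V"
    using j card_circles_two(1)[OF lt] ab by simp_all
  then have "P = {}"
    using finite_subset[OF P finite_circles] by simp
  then show ?thesis
    using that ab lt S card_circles_two(2)[OF lt eq] by blast
qed

text \<open>All circles of the target are positive, so the one negative circle \<open>v\<close> must
  be affected by the flip. The source has no negative marker, so every sign is
  \<open>+1\<close>.\<close>

lemma lookup_differential_top:
  assumes x: "Poly_Mapping.keys x \<subseteq> generators D (int N) J" and c: "c < N"
  shows "Poly_Mapping.lookup (differential D (int N) J x) (enhanced D {c} {}) =
    (\<Sum>v \<in> touching D (marking D {}) c. Poly_Mapping.lookup x (enhanced D {} {v}))"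
proof -
  have inj: "inj_on (\<lambda>v. enhanced D {} {v}) V"
    by (rule inj_onI) (simp add: enhanced_eq_iff)
  have coef: "coef D (enhanced D {} {v}) (enhanced D {c} {}) = (if touches v c then 1 else 0)"
    if "v \<in> V" for v
    using coef_insert[of c "{}" "{v}" "{}"] c that by auto
  have "Poly_Mapping.lookup (differential D (int N) J x) (enhanced D {c} {}) =
      (\<Sum>S \<in> generators D (int N) J. Poly_Mapping.lookup x S * coef D S (enhanced D {c} {}))"
    using c by (simp add: lookup_differential[OF finite_generators finite_generators x] generators_middle)
  also have "\<dots> = (\<Sum>v\<in>V. Poly_Mapping.lookup x (enhanced D {} {v}) *
      coef D (enhanced D {} {v}) (enhanced D {c} {}))"
    unfolding generators_top by (simp add: sum.reindex[OF inj])
  also have "\<dots> = (\<Sum>v\<in>V. if touches v c then Poly_Mapping.lookup x (enhanced D {} {v}) else 0)"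
    by (rule sum.cong) (auto simp: coef)
  also have "\<dots> = (\<Sum>v \<in> touching D (marking D {}) c. Poly_Mapping.lookup x (enhanced D {} {v}))"
    unfolding touching_def by (rule sum.inter_filter[symmetric]) (rule finite_circles)
  finally show ?thesis .
qed

text \<open>From \<open>{a}\<close> the flip is at \<open>b\<close>, with no negative marker beyond
  it. From \<open>{b}\<close> the flip is at \<open>a\<close>, and the negative marker at
  \<open>b\<close> lies beyond it and contributes the minus sign. Any other \<open>c\<close> differs
  from the target at three crossings.\<close>

lemma lookup_differential_middle:
  assumes y: "Poly_Mapping.keys y \<subseteq> generators D (int N - 2) J" and ab: "a < b" "b < N"
    and Y: "enhanced D {a, b} {} \<in> generators D (int N - 2 - 2) J"
  shows "Poly_Mapping.lookup (differential D (int N - 2) J y) (enhanced D {a, b} {}) =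
    Poly_Mapping.lookup y (enhanced D {a} {}) - Poly_Mapping.lookup y (enhanced D {b} {})"
proof -
  let ?Y = "enhanced D {a, b} {}"
  let ?f = "\<lambda>c. Poly_Mapping.lookup y (enhanced D {c} {})"
  have inj: "inj_on (\<lambda>c. enhanced D {c} {}) {..<N}"
    by (rule inj_onI) (simp add: enhanced_eq_iff)
  have coef: "coef D (enhanced D {c} {}) ?Y = (if c = a then 1 else 0) - (if c = b then 1 else 0)"
    if "c < N" for c
  proof -
    consider "c = a" | "c = b" | "c \<noteq> a" "c \<noteq> b" by blast
    then show ?thesis
    proof cases
      case 1
      have empty: "{x. x = a \<and> b < x} = {}" using ab by auto
      show ?thesis
        using 1 ab coef_insert[of b "{a}" "{}" "{}"] by (simp add: insert_commute empty)
    next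
      case 2
      have single: "{x. x = b \<and> a < x} = {b}" using ab by auto
      show ?thesis
        using 2 ab coef_insert[of a "{b}" "{}" "{}"] by (simp add: single)
    next
      case 3
      have "differing D (enhanced D {c} {}) ?Y = {a, b, c}"
        using 3 ab that by (subst differing_enhanced) auto
      then show ?thesis
        using 3 ab by (subst coef_eq_0) auto
    qed
  qed
  have "Poly_Mapping.lookup (differential D (int N - 2) J y) ?Y =
      (\<Sum>S \<in> generators D (int N - 2) J. Poly_Mapping.lookup y S * coef D S ?Y)"
    using Y by (simp add: lookup_differential[OF finite_generators finite_generators y])
  also have "\<dots> = (\<Sum>c<N. ?f c * coef D (enhanced D {c} {}) ?Y)"
    unfolding generators_middle by (simp add: sum.reindex[OF inj])
  also have "\<dots> = (\<Sum>c<N. (if c = a then ?f c else 0) - (if c = b then ?f c else 0))"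
    by (rule sum.cong) (auto simp: coef)
  also have "\<dots> = ?f a - ?f b"
    using ab by (simp add: sum_subtractf)
  finally show ?thesis .
qed

lemma torsion:
  assumes "has_odd_cycle (state_graph D (marking D {}))"
  shows "has_Z2_torsion (khovanov_homology D (int N - 2) J)"
proof -
  define z where "z = (\<Sum>X \<in> generators D (int N - 2) J. frag_of X)"
  define w where "w = (\<Sum>X \<in> generators D (int N) J. frag_of X)"
  have kz: "Poly_Mapping.keys z \<subseteq> generators D (int N - 2) J"
    unfolding z_def by (rule order.trans[OF keys_sum]) auto
  have kw: "Poly_Mapping.keys w \<subseteq> generators D (int N) J"
    unfolding w_def by (rule order.trans[OF keys_sum]) auto
  have lz: "Poly_Mapping.lookup z (enhanced D {c} {}) = 1" if "c < N" for c
    unfolding z_def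
    by (subst lookup_sum_frag_of) (use that in \<open>auto simp: finite_generators generators_middle\<close>)
  have lw: "Poly_Mapping.lookup w (enhanced D {} {v}) = 1" if "v \<in> V" for v
    unfolding w_def
    by (subst lookup_sum_frag_of) (use that in \<open>auto simp: finite_generators finite_circles generators_top\<close>)
  have off: "Poly_Mapping.lookup y S = 0"
    if "Poly_Mapping.keys y \<subseteq> generators D (int N - 2) J" "S \<notin> (\<lambda>c. enhanced D {c} {}) ` {..<N}" for y S
    using that unfolding generators_middle by (meson in_keys_iff subsetD)
  \<comment> \<open>A chain with equal coefficients on parallel edges is a cycle. This serves both
    for \<open>z\<close> and for the boundaries from the top degree.\<close>
  have cycle: "differential D (int N - 2) J y = 0"
    if y: "Poly_Mapping.keys y \<subseteq> generators D (int N - 2) J"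
      and eq: "\<And>a b. a < N \<Longrightarrow> b < N \<Longrightarrow> touching D (marking D {}) a = touching D (marking D {}) b \<Longrightarrow>
        Poly_Mapping.lookup y (enhanced D {a} {}) = Poly_Mapping.lookup y (enhanced D {b} {})" for y
  proof (rule poly_mapping_eqI)
    fix S
    show "Poly_Mapping.lookup (differential D (int N - 2) J y) S = Poly_Mapping.lookup 0 S"
    proof (cases "S \<in> generators D (int N - 2 - 2) J")
      case True
      then obtain a b where "a < b" "b < N" "S = enhanced D {a, b} {}"
        "touching D (marking D {}) a = touching D (marking D {}) b"
        by (rule generators_bottom)
      then show ?thesis
        using lookup_differential_middle[OF y, of a b] True eq[of a b] by simp
    next
      case False
      then show ?thesis
        by (simp add: lookup_differential[OF finite_generators finite_generators y])
    qed
  qed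
  \<comment> \<open>The coefficient of a boundary at \<open>c\<close> depends only on the ends of
    \<open>c\<close>, so parallel edges get the same coefficient.\<close>
  have dd: "differential D (int N - 2) J (differential D (int N) J x) = 0"
    if "Poly_Mapping.keys x \<subseteq> generators D (int N) J" for x
    by (rule cycle) (auto simp: lookup_differential_top[OF that] intro: differential_keys[THEN subsetD])
  have dz: "differential D (int N - 2) J z = 0"
    by (rule cycle) (use kz lz in auto)
  have ww: "z + z = differential D (int N) J w"
  proof (rule poly_mapping_eqI)
    fix S
    show "Poly_Mapping.lookup (z + z) S = Poly_Mapping.lookup (differential D (int N) J w) S"
    proof (cases "S \<in> (\<lambda>c. enhanced D {c} {}) ` {..<N}")
      case True
      then obtain c where c: "c < N" "S = enhanced D {c} {}" by auto
      have "(\<Sum>v \<in> touching D (marking D {}) c. Poly_Mapping.lookup w (enhanced D {} {v})) =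
          (\<Sum>v \<in> touching D (marking D {}) c. 1)"
        by (rule sum.cong) (auto simp: touching_def lw)
      then show ?thesis
        using c by (simp add: lookup_differential_top[OF kw] lookup_add lz card_touching_2)
    next
      case False
      then show ?thesis
        using off[OF kz] off[OF differential_keys] by (simp add: lookup_add)
    qed
  qed
  have nb: "z \<noteq> differential D (int N) J u" if u: "Poly_Mapping.keys u \<subseteq> generators D (int N) J" for u
  proof
    assume zu: "z = differential D (int N) J u"
    let ?f = "\<lambda>v. Poly_Mapping.lookup u (enhanced D {} {v})"
    obtain vs es where cyc: "is_cycle (state_graph D (marking D {})) vs es" "odd (length es)"
      using assms unfolding has_odd_cycle_def by blast
    \<comment> \<open>The shift \<open>2 * f - 1\<close> makes the equation
      \<open>f a + f b = 1\<close> homogeneous. The odd cycle then gives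
      \<open>2 * f - 1 = 0\<close> at its start, contradicting parity.\<close>
    have "(2 * ?f (vs ! 0) - 1) + (2 * ?f (vs ! 0) - 1) \<in> {0 :: int}"
    proof (rule odd_cycle_double[OF cyc])
      fix e a b
      assume "e \<in> edges (state_graph D (marking D {}))" and ends: "ends (state_graph D (marking D {})) e = {a, b}"
      then have e: "e < N" by (simp add: state_graph_def)
      then have "a \<noteq> b" "touching D (marking D {}) e = {a, b}"
        using card_touching_2[OF e] ends by (auto simp: ends_state_graph)
      then have "?f a + ?f b = 1"
        using lookup_differential_top[OF u e] lz[OF e] zu by simp
      then show "(2 * ?f a - 1) + (2 * ?f b - 1) \<in> {0 :: int}" by simp
    qed auto
    then show False by simp presburger
  qed
  show ?thesis
    by (rule khovanov_Z2_torsionI[of D "int N - 2" J z w]) (use dd kz dz kw ww nb in simp_all)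
qed

end

section \<open>The minus-adequate case\<close>

locale minus_adequate_diagram = glued +
  assumes card_touching_2:
    "\<And>c. c < num_crossings D \<Longrightarrow> card (touching D (marking D {..<num_crossings D}) c) = 2"
begin

abbreviation (input) "N \<equiv> num_crossings D"
abbreviation (input) "V \<equiv> circles D (marking D {..<N})"
text \<open>The second degree of the all-negative state with exactly one positive circle, where
  \<open>tau\<close> is \<open>2 - card V\<close>. A state with one positive marker and all circles
  negative has the same second degree, since the flip loses one circle.\<close>

abbreviation (input) "J \<equiv> - int N - 2 * int (card V) + 4"
abbreviation "vertex_state v \<equiv> enhanced D {..<N} (V - {v})"
abbreviation "edge_state c \<equiv> enhanced D ({..<N} - {c}) (circles D (marking D ({..<N} - {c})))"

lemma card_circles_one:
  assumes c: "c < N"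
  shows "card V = Suc (card (circles D (marking D ({..<N} - {c}))))"
proof -
  let ?M = "{..<N} - {c}"
  have ins: "{..<N} = insert c ?M" using c by auto
  have "\<And>b. b \<noteq> c \<Longrightarrow> marking D {..<N} b = marking D ?M b"
    using marking_insert[of _ c D ?M] ins by metis
  moreover have "marking D {..<N} c \<noteq> marking D ?M c"
    using marking_insert_neq[OF c, of ?M] ins by (metis DiffD2 singletonI)
  ultimately show ?thesis
    using flip_merge(2)[OF c, of "marking D {..<N}" "marking D ?M"] card_touching_2[OF c] by metis
qed

lemma generators_vertex: "generators D (- int N) J = vertex_state ` V"
proof
  show "generators D (- int N) J \<subseteq> vertex_state ` V"
  proof
    fix S assume "S \<in> generators D (- int N) J"
    then obtain M P where S: "S = enhanced D M P" and M: "M \<subseteq> {..<N}"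
      and P: "P \<subseteq> circles D (marking D M)" and i: "- int N = int N - 2 * int (card M)"
      and j: "J = - int N + 2 * (int (card (circles D (marking D M))) - 2 * int (card P))"
      unfolding generators_eq by blast
    have M: "M = {..<N}"
      using i M by (intro card_subset_eq) auto
    then have "card V = Suc (card P)"
      using j by simp
    then have "card (V - P) = 1"
      using P M card_Diff_subset[of P V] finite_subset[OF P finite_circles] by simp
    then obtain v where "V - P = {v}" by (rule card_1_singletonE)
    then have "P = V - {v}" "v \<in> V"
      using P M by auto
    then show "S \<in> vertex_state ` V"
      using S M by auto
  qed
  show "vertex_state ` V \<subseteq> generators D (- int N) J"
  proof (rule image_subsetI)
    fix v assume "v \<in> V"
    define k where "k = card (V - {v})"
    have card: "card V = Suc k"
      unfolding k_def by (rule card.remove[OF finite_circles \<open>v \<in> V\<close>])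
    show "vertex_state v \<in> generators D (- int N) J"
    proof (rule enhanced_in_generators)
      show "J = - int N + 2 * (int (card V) - 2 * int (card (V - {v})))"
        unfolding k_def[symmetric] card by simp
    qed auto
  qed
qed

lemma generators_edge: "generators D (- int N + 2) J = edge_state ` {..<N}"
proof
  show "generators D (- int N + 2) J \<subseteq> edge_state ` {..<N}"
  proof
    fix S assume "S \<in> generators D (- int N + 2) J"
    then obtain M P where S: "S = enhanced D M P" and M: "M \<subseteq> {..<N}"
      and P: "P \<subseteq> circles D (marking D M)" and i: "- int N + 2 = int N - 2 * int (card M)"
      and j: "J = - int N + 2 + 2 * (int (card (circles D (marking D M))) - 2 * int (card P))"
      unfolding generators_eq by blast
    have "card ({..<N} - M) = 1"
      using i M card_Diff_subset[of M "{..<N}"] finite_subset[OF M] by simp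
    then obtain c where "{..<N} - M = {c}" by (rule card_1_singletonE)
    then have c: "M = {..<N} - {c}" "c < N"
      using M by auto
    then have "card P = card (circles D (marking D M))"
      using j card_circles_one[of c] by simp
    then have "P = circles D (marking D M)"
      by (rule card_subset_eq[OF finite_circles P])
    then show "S \<in> edge_state ` {..<N}"
      using S c by auto
  qed
  have "N = Suc (card ({..<N} - {c}))" if "c < N" for c
    using that by simp
  then show "edge_state ` {..<N} \<subseteq> generators D (- int N + 2) J"
    using card_circles_one by (auto intro!: enhanced_in_generators)
qed

text \<open>Such a generator would have \<open>N + 1\<close> negative markers. Consequently every
  chain in degree \<open>- int N\<close> is a cycle.\<close>

lemma generators_below: "generators D (- int N - 2) J = {}"
proof -
  have "S \<notin> generators D (- int N - 2) J" for S
  proof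
    assume "S \<in> generators D (- int N - 2) J"
    then obtain M where "M \<subseteq> {..<N}" "- int N - 2 = int N - 2 * int (card M)"
      unfolding generators_eq by blast
    then show False
      using card_mono[of "{..<N}" M] by simp
  qed
  then show ?thesis by blast
qed

text \<open>The sign with which the differential flips the one positive marker at \<open>c\<close>;
  it depends on \<open>c\<close> alone and is therefore common to both ends of the edge.\<close>

definition edge_sign :: "nat \<Rightarrow> int" where
  "edge_sign c = (- 1) ^ card {b \<in> {..<N} - {c}. c < b}"

text \<open>The source has only negative circles, so the one positive circle \<open>v\<close> of the
  target must touch \<open>c\<close>.\<close>

lemma coef_edge_vertex:
  assumes c: "c < N" and v: "v \<in> V"
  shows "coef D (edge_state c) (vertex_state v) = (if touches v c then edge_sign c else 0)"
proof -
  let ?M = "{..<N} - {c}"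
  have ins: "insert c ?M = {..<N}" using c by auto
  have mem: "C \<in> circles D (marking D ?M) \<longleftrightarrow> C \<in> V" if "\<not> touches C c" for C
    using circles_marking_insert[OF that, of ?M] unfolding ins .
  then have "(\<forall>C \<in> circles D (marking D ?M). \<not> touches C c \<longrightarrow>
      (C \<in> circles D (marking D ?M) \<longleftrightarrow> C \<in> V - {v})) \<longleftrightarrow> touches v c"
    using v by auto
  then show ?thesis
    using coef_insert[of c ?M "circles D (marking D ?M)" "V - {v}"] unfolding ins edge_sign_def by simp
qed

lemma lookup_differential_edge:
  assumes x: "Poly_Mapping.keys x \<subseteq> generators D (- int N + 2) J" and v: "v \<in> V"
  shows "Poly_Mapping.lookup (differential D (- int N + 2) J x) (vertex_state v) =
    (\<Sum>c<N. Poly_Mapping.lookup x (edge_state c) * (if touches v c then edge_sign c else 0))"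
proof -
  have inj: "inj_on edge_state {..<N}"
    by (rule inj_onI) (subst (asm) enhanced_eq_iff; auto)
  have "vertex_state v \<in> generators D (- int N + 2 - 2) J"
    using v generators_vertex by simp
  then have "Poly_Mapping.lookup (differential D (- int N + 2) J x) (vertex_state v) =
      (\<Sum>S \<in> generators D (- int N + 2) J. Poly_Mapping.lookup x S * coef D S (vertex_state v))"
    by (simp only: lookup_differential[OF finite_generators finite_generators x] if_True)
  also have "\<dots> = (\<Sum>c<N. Poly_Mapping.lookup x (edge_state c) * coef D (edge_state c) (vertex_state v))"
    unfolding generators_edge by (simp add: sum.reindex[OF inj])
  also have "\<dots> = (\<Sum>c<N. Poly_Mapping.lookup x (edge_state c) * (if touches v c then edge_sign c else 0))"
    by (rule sum.cong) (auto simp: coef_edge_vertex[OF _ v])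
  finally show ?thesis .
qed

lemma vertex_state_eq_iff: "u \<in> V \<Longrightarrow> v \<in> V \<Longrightarrow> vertex_state u = vertex_state v \<longleftrightarrow> u = v"
  by (subst enhanced_eq_iff) auto

lemma edge_state_eq_iff: "c < N \<Longrightarrow> e < N \<Longrightarrow> edge_state c = edge_state e \<longleftrightarrow> c = e"
  by (subst enhanced_eq_iff) auto

lemma torsion:
  assumes "has_odd_cycle (state_graph D (marking D {..<N}))"
  shows "has_Z2_torsion (khovanov_homology D (- int N) J)"
proof -
  let ?d = "differential D (- int N + 2) J" and ?C = "{x. Poly_Mapping.keys x \<subseteq> generators D (- int N + 2) J}"
  let ?G = "state_graph D (marking D {..<N})"
  obtain vs es where cyc: "is_cycle ?G vs es" "odd (length es)"
    using assms unfolding has_odd_cycle_def by blast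
  define v where "v = vs ! 0"
  have v: "v \<in> V"
    using cyc by (auto simp: is_cycle_def v_def state_graph_def)
  define z where "z = frag_of (vertex_state v)"
  have kz: "Poly_Mapping.keys z \<subseteq> generators D (- int N) J"
    using v by (simp add: z_def generators_vertex)
  have d0: "differential D (- int N) J x = 0" for x
    using differential_keys[of D "- int N" J x] generators_below by simp
  have bdry: "frag_of (vertex_state a) + frag_of (vertex_state b) \<in> ?d ` ?C"
    if e: "e \<in> edges ?G" "ends ?G e = {a, b}" for e a b
  proof
    have eN: "e < N" using e by (simp add: state_graph_def)
    have t: "touching D (marking D {..<N}) e = {a, b}"
      using e by (simp add: ends_state_graph)
    then have ab: "a \<noteq> b" "a \<in> V" "b \<in> V"
      using card_touching_2[OF eN] by (auto simp: touching_def)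
    \<comment> \<open>The factor \<open>edge_sign e\<close> cancels the sign in the differential, so
      both ends of \<open>e\<close> get coefficient 1.\<close>
    let ?x = "frag_cmul (edge_sign e) (frag_of (edge_state e))"
    have "edge_state e \<in> generators D (- int N + 2) J"
      unfolding generators_edge using eN by blast
    then show x: "?x \<in> ?C"
      unfolding mem_Collect_eq by (intro order.trans[OF keys_cmul]) simp
    have sq: "edge_sign e * edge_sign e = 1"
      by (simp add: edge_sign_def flip: power_mult_distrib)
    show "frag_of (vertex_state a) + frag_of (vertex_state b) = ?d ?x"
    proof (rule poly_mapping_eqI)
      fix S
      show "Poly_Mapping.lookup (frag_of (vertex_state a) + frag_of (vertex_state b)) S =
        Poly_Mapping.lookup (?d ?x) S"
      proof (cases "S \<in> vertex_state ` V")
        case True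
        then obtain u where u: "u \<in> V" "S = vertex_state u" by auto
        have "touches u e \<longleftrightarrow> u \<in> touching D (marking D {..<N}) e"
          using u by (simp add: touching_def)
        then have tu: "touches u e \<longleftrightarrow> u = a \<or> u = b"
          using t by simp
        have "Poly_Mapping.lookup (?d ?x) S =
            (\<Sum>c<N. Poly_Mapping.lookup ?x (edge_state c) * (if touches u c then edge_sign c else 0))"
          using lookup_differential_edge[of ?x u] x u by simp
        also have "\<dots> = (\<Sum>c<N. if c = e then (if touches u e then 1 else 0) else 0)"
          by (rule sum.cong) (use eN sq in \<open>auto simp: edge_state_eq_iff\<close>)
        also have "\<dots> = (if u = a \<or> u = b then 1 else 0)"
          using eN tu by simp
        finally show ?thesis
          using u ab by (simp add: lookup_add vertex_state_eq_iff)
      next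
        case False
        have "Poly_Mapping.keys (?d ?x) \<subseteq> vertex_state ` V"
          using differential_keys[of D "- int N + 2" J ?x] generators_vertex by simp
        then have "Poly_Mapping.lookup (?d ?x) S = 0"
          using False by (meson in_keys_iff subsetD)
        then show ?thesis
          using False ab by (auto simp: lookup_add)
      qed
    qed
  qed
  have "z + z \<in> ?d ` ?C"
    unfolding z_def v_def
  \<comment> \<open>Here \<open>I\<close> is the group of boundaries, and \<open>bdry\<close>
    supplies the relation for each edge.\<close>
  proof (rule odd_cycle_double[OF cyc, where g = "\<lambda>v. frag_of (vertex_state v)"])
    have "?d 0 = 0" by (simp add: differential_def)
    then show "0 \<in> ?d ` ?C" by (metis (mono_tags) image_eqI keys_zero empty_subsetI mem_Collect_eq)
    fix x y assume "x \<in> ?d ` ?C" "y \<in> ?d ` ?C"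
    then obtain p q where pq: "x = ?d p" "y = ?d q" "p \<in> ?C" "q \<in> ?C" by auto
    have "x + y = ?d (p + q)" "p + q \<in> ?C"
      using pq keys_add[of p q] by (auto simp: differential_add)
    then show "x + y \<in> ?d ` ?C" by blast
    have "x - y = ?d (p - q)" "p - q \<in> ?C"
      using pq keys_diff[of p q] by (auto simp: differential_def frag_extend_diff)
    then show "x - y \<in> ?d ` ?C" by blast
  qed (rule bdry)
  then obtain w where w: "Poly_Mapping.keys w \<subseteq> generators D (- int N + 2) J" "z + z = ?d w"
    by auto
  have nb: "z \<noteq> ?d u" if u: "Poly_Mapping.keys u \<subseteq> generators D (- int N + 2) J" for u
  proof
    assume zu: "z = ?d u"
    \<comment> \<open>The coefficient sum over the vertices tells \<open>z\<close> from a boundary: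
      it is 1 for \<open>z\<close>, while each edge contributes equally at its two ends and makes it
      even for a boundary.\<close>
    have "(\<Sum>x\<in>V. Poly_Mapping.lookup z (vertex_state x)) = (\<Sum>x\<in>V. if x = v then 1 else 0)"
      by (rule sum.cong) (use v in \<open>auto simp: z_def vertex_state_eq_iff\<close>)
    also have "\<dots> = 1" using v by (simp add: finite_circles)
    finally have one: "(\<Sum>x\<in>V. Poly_Mapping.lookup z (vertex_state x)) = 1" .
    have "(\<Sum>x\<in>V. Poly_Mapping.lookup z (vertex_state x)) =
        (\<Sum>x\<in>V. \<Sum>c<N. Poly_Mapping.lookup u (edge_state c) * (if touches x c then edge_sign c else 0))"
      unfolding zu by (rule sum.cong[OF refl]) (rule lookup_differential_edge[OF u])
    also have "\<dots> = (\<Sum>c<N. \<Sum>x\<in>V. Poly_Mapping.lookup u (edge_state c) * (if touches x c then edge_sign c else 0))"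
      by (rule sum.swap)
    also have "\<dots> = (\<Sum>c<N. 2 * (Poly_Mapping.lookup u (edge_state c) * edge_sign c))"
    proof (rule sum.cong)
      fix c assume "c \<in> {..<N}"
      then have "card {x \<in> V. touches x c} = 2"
        using card_touching_2[of c] by (simp add: touching_def)
      then show "(\<Sum>x\<in>V. Poly_Mapping.lookup u (edge_state c) * (if touches x c then edge_sign c else 0)) =
          2 * (Poly_Mapping.lookup u (edge_state c) * edge_sign c)"
        by (simp add: finite_circles flip: sum_distrib_left sum.inter_filter)
    qed simp
    also have "\<dots> = 2 * (\<Sum>c<N. Poly_Mapping.lookup u (edge_state c) * edge_sign c)"
      by (simp add: sum_distrib_left)
    finally show False using one by presburger
  qed
  show ?thesis
    by (rule khovanov_Z2_torsionI[of D "- int N" J z w]) (use d0 kz w nb in simp_all)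
qed

end

theorem theoremX2p2:
  fixes D :: diagram and N :: nat
  assumes "link_diagram D" and "N = num_crossings D"
  shows "(plus_adequate D \<and> has_odd_cycle (state_graph D (s_plus D)) \<longrightarrow>
            has_Z2_torsion (khovanov_homology D (int N - 2)
              (int N + 2 * int (card (circles D (s_plus D))) - 4))) \<and>
         (minus_adequate D \<and> has_odd_cycle (state_graph D (s_minus D)) \<longrightarrow>
            has_Z2_torsion (khovanov_homology D (- int N)
              (- int N - 2 * int (card (circles D (s_minus D))) + 4)))"
proof -
  interpret glued D
    using assms(1) by unfold_locales (auto simp: link_diagram_def)
  show ?thesis
  proof (intro conjI impI; elim conjE)
    assume adequate: "plus_adequate D" and odd: "has_odd_cycle (state_graph D (s_plus D))"
    interpret plus_adequate_diagram D
      using adequate loopless_card_touching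
      by unfold_locales (simp add: plus_adequate_def s_plus_eq)
    show "has_Z2_torsion (khovanov_homology D (int N - 2)
        (int N + 2 * int (card (circles D (s_plus D))) - 4))"
      using torsion odd unfolding s_plus_eq assms(2) .
  next
    assume adequate: "minus_adequate D" and odd: "has_odd_cycle (state_graph D (s_minus D))"
    interpret minus_adequate_diagram D
      using adequate loopless_card_touching
      by unfold_locales (simp add: minus_adequate_def s_minus_eq)
    show "has_Z2_torsion (khovanov_homology D (- int N)
        (- int N - 2 * int (card (circles D (s_minus D))) + 4))"
      using torsion odd unfolding s_minus_eq assms(2) .
  qed
qed

end
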